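(* For any iterates $k$ and $j$ of Algorithms PD-PMM and SSN, respectively, every eigenvalue $\lambda$ of the matrix $\widetilde S_{k_j}^{-1}\widehat S_{k_j}$ satisfies $$1\le\lambda\le1+\sigma_{\max}^2(A)\left(\frac{1}{1+\beta_\infty^{-2}\tau_\infty}\right),$$ where $\sigma_{\max}(A)$ is the largest singular value of $A$, and $\beta_\infty\le\infty$, $\tau_\infty>0$ are the limits of the sequences $\{\beta_k\}$, $\{\tau_k\}$ of Algorithm PD-PMM (with $\beta_\infty^{-2}=0$ if $\beta_\infty=\infty$).
   Context: Problem data: $c \in \mathbb{R}^n$, $Q \in \mathbb{R}^{n\times n}$ symmetric positive semidefinite, $A \in \mathbb{R}^{m\times n}$ with $m \le n$, $b\in\mathbb{R}^m$, $g(x)=\|Dx\|_1$ with $D\in\mathbb{R}^{n\times n}$ diagonal and positive semidefinite, and $\mathcal{K}=\{x\in\mathbb{R}^n : a_l\le x\le a_u\}$ where $a_l\le a_u$ are vectors whose entries may be infinite. $\delta_{\mathcal K}$ is the indicator function of $\mathcal{K}$, $^*$ on a function denotes the Fenchel conjugate, $\Pi_{\mathcal{C}}$ is Euclidean projection, $\|\cdot\|$ the Euclidean norm, $\mathrm{dist}$ the Euclidean distance, $\partial$ the convex subdifferential, and $\mathbf{prox}_p(u)=\arg\min_x\{p(x)+\frac12\|u-x\|^2\}$. Standing assumption: the problem (P) $\min_x c^\top x+\frac12x^\top Qx+g(x)+\delta_{\mathcal{K}}(x)$ s.t. $Ax=b$, and its dual (D) $\max_{x,y,z} b^\top y-\frac12x^\top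 Qx-\delta^*_{\mathcal{K}}(z)-g^*(A^\top y-c-Qx-z)$, are both feasible. Algorithm PD-PMM. Input: $(x_0,y_0,z_0)\in\mathbb{R}^n\times\mathbb{R}^m\times\mathbb{R}^n$; positive non-increasing $\{\tau_k\}$ with limit $\tau_\infty>0$; non-decreasing $\{\beta_k\}$ with $\beta_0>0$, $\beta_k\nearrow\beta_\infty\le\infty$; $\rho_k=\beta_k/\tau_k$; positive tolerances $\epsilon_k\to0$. For each $k\ge 0$, find $(x_{k+1},y_{k+1})$ with $\mathrm{dist}(0,F_{\beta_k,\rho_k}(x_{k+1},y_{k+1}))\le\epsilon_k$ and set $z_{k+1}=(z_k+\beta_kx_{k+1})-\beta_k\Pi_{\mathcal{K}}(\beta_k^{-1}z_k+x_{k+1})$, where $r_{\beta_k,\rho_k}(x,y)=c+Qx-A^\top y+(z_k+\beta_kx)-\beta_k\Pi_{\mathcal{K}}(\beta_k^{-1}z_k+x)+\rho_k^{-1}(x-x_k)$ and $F_{\beta_k,\rho_k}(x,y)=\{(u',v'):u'\in r_{\beta_k,\rho_k}(x,y)+\partial g(x),\ v'=Ax+\beta_k^{-1}(y-y_k)-b\}$. Algorithm SSN (semismooth Newton, inner method for the $k$-th sub-problem). Fix $\zeta_k>0$, $\mu\in(0,\frac12)$, $\delta\in(0,1)$, $\eta_j\in(0,1)$, and start from $(x_{k_0},y_{k_0})=(x_k,y_k)$. With $$\widehat F(x,y)=\begin{bmatrix}x-\mathbf{prox}_{\zeta_kg}(x-\zeta_kr_{\beta_k,\rho_k}(x,y))\\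 \zeta_k(Ax+\beta_k^{-1}(y-y_k)-b)\end{bmatrix},$$ at iteration $j$ find $(d_x,d_y)$ with $\|M_{k_j}(d_x,d_y)+\widehat F(x_{k_j},y_{k_j})\|\le\eta_j\|\widehat F(x_{k_j},y_{k_j})\|$, where $$M_{k_j}=\begin{bmatrix}(I_n-\widehat B_{k_j})+\zeta_k\widehat B_{k_j}H_{k_j}&-\zeta_k\widehat B_{k_j}A^\top\\ \zeta_kA&\zeta_k\beta_k^{-1}I_m\end{bmatrix},$$ and set $(x_{k_{j+1}},y_{k_{j+1}})=(x_{k_j},y_{k_j})+\alpha_j(d_x,d_y)$ with $\alpha_j=\delta^{m_j}$, $m_j$ the first non-negative integer such that $\Theta((x_{k_j},y_{k_j})+\delta^{m_j}(d_x,d_y))\le(1-2\mu\delta^{m_j})\Theta(x_{k_j},y_{k_j})$, $\Theta=\|\widehat F\|^2$; the iterations stop when $\mathrm{dist}(0,F_{\beta_k,\rho_k})\le\epsilon_k$ is met. Matrices at inner-outer iteration $k_j$. Let $\widehat u_{k_j}=x_{k_j}-\zeta_kr_{\beta_k,\rho_k}(x_{k_j},y_{k_j})$. $B_{k_j}$ and $\widehat B_{k_j}$ are the diagonal $n\times n$ matrices with: $B_{k_j,(i,i)}=1$ if $\beta_k^{-1}z_{k,i}+x_{k_j,i}\in(a_{l_i},a_{u_i})$ and $0$ otherwise; $\widehat B_{k_j,(i,i)}=1$ if $|\widehat u_{k_j,i}|>\zeta_kD_{(i,i)}$ or $D_{(i,i)}=0$, and $0$ otherwise. Put $$H_{k_j}=Q+(\beta_k+\rho_k^{-1})I_n-\beta_kB_{k_j},\qquad\widehat{\mathcal{B}}_j=\{i:\widehat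 B_{k_j,(i,i)}=1\}.$$ $A_{\widehat{\mathcal{B}}_j}$ denotes the columns of $A$ with indices in $\widehat{\mathcal{B}}_j$, and $H_{k_j,(\widehat{\mathcal{B}}_j,\widehat{\mathcal{B}}_j)}$ the corresponding principal submatrix of $H_{k_j}$. Let $\widetilde H_{k_j,(\widehat{\mathcal{B}}_j,\widehat{\mathcal{B}}_j)}$ be the diagonal matrix with the same diagonal as $H_{k_j,(\widehat{\mathcal{B}}_j,\widehat{\mathcal{B}}_j)}$, and let $E_{k_j}$ be the $|\widehat{\mathcal{B}}_j|\times|\widehat{\mathcal{B}}_j|$ diagonal matrix whose entry at the position of index $i\in\widehat{\mathcal{B}}_j$ is the reciprocal of the corresponding diagonal entry of $\widetilde H_{k_j,(\widehat{\mathcal{B}}_j,\widehat{\mathcal{B}}_j)}$ if $\beta_k^{-1}z_{k,i}+x_{k_j,i}\in(a_{l_i},a_{u_i})$, and $0$ otherwise. Finally, $$\widehat S_{k_j}=A_{\widehat{\mathcal{B}}_j}\widetilde H_{k_j,(\widehat{\mathcal{B}}_j,\widehat{\mathcal{B}}_j)}^{-1}A_{\widehat{\mathcal{B}}_j}^\top+\beta_k^{-1}I_m,\qquad\widetilde S_{k_j}=A_{\widehat{\mathcal{B}}_j}E_{k_j}A_{\widehat{\mathcal{B}}_j}^\top+\beta_k^{-1}I_m.$$ *)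

theory Defs
  imports "HOL-Analysis.Analysis"
begin

section \<open>Linear algebra\<close>

definition psd :: "real^'n^'n \<Rightarrow> bool" where
  "psd M \<longleftrightarrow> (\<forall>x. 0 \<le> x \<bullet> (M *v x))"

definition is_diagonal :: "'a::zero^'n^'n \<Rightarrow> bool" where
  "is_diagonal M \<longleftrightarrow> (\<forall>i j. i \<noteq> j \<longrightarrow> M $ i $ j = 0)"

definition diag_mat :: "('n \<Rightarrow> 'a::zero) \<Rightarrow> 'a^'n^'n" where
  "diag_mat d = (\<chi> i j. if i = j then d i else 0)"

definition eigenvalue :: "'a::field^'n^'n \<Rightarrow> 'a \<Rightarrow> bool" where
  "eigenvalue M l \<longleftrightarrow> (\<exists>v. v \<noteq> 0 \<and> M *v v = l *s v)"

definition singular_values :: "real^'n^'m \<Rightarrow> real set" where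
  "singular_values M = sqrt ` {l. eigenvalue (transpose M ** M) l}"

definition sigma_max :: "real^'n^'m \<Rightarrow> real" where
  "sigma_max M = Max (singular_values M)"

text \<open>
  Submatrices whose index sets depend on the data cannot have their size in the type. The
  submatrix of \<open>M\<close> with rows \<open>I\<close> and columns \<open>J\<close> is represented by padding it with zeros to the
  size of \<open>M\<close>; this commutes with sums, transposes and products of conformable matrices. The unit of the ring of
  padded \<open>J \<times> J\<close> matrices is \<open>submat J J (mat 1)\<close>, so \<open>submat_inv J\<close> is the inverse of a
  \<open>J \<times> J\<close> matrix, again padded with zeros.
\<close>

definition submat :: "'m set \<Rightarrow> 'n set \<Rightarrow> 'a::zero^'n^'m \<Rightarrow> 'a^'n^'m" where
  "submat I J M = (\<chi> i j. if i \<in> I \<and> j \<in> J then M $ i $ j else 0)"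

definition submat_inv :: "'n set \<Rightarrow> real^'n^'n \<Rightarrow> real^'n^'n" where
  "submat_inv J M = (THE N. submat J J N = N \<and>
     M ** N = submat J J (mat 1) \<and> N ** M = submat J J (mat 1))"

section \<open>Convex analysis\<close>

definition fenchel_conj :: "(real^'n \<Rightarrow> ereal) \<Rightarrow> real^'n \<Rightarrow> ereal" where
  "fenchel_conj f z = (SUP x. ereal (z \<bullet> x) - f x)"

definition indicator_fun :: "(real^'n) set \<Rightarrow> real^'n \<Rightarrow> ereal" where
  "indicator_fun S x = (if x \<in> S then 0 else \<infinity>)"

definition subdiff :: "(real^'n \<Rightarrow> real) \<Rightarrow> real^'n \<Rightarrow> (real^'n) set" where
  "subdiff f x = {s. \<forall>y. f y \<ge> f x + s \<bullet> (y - x)}"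

definition prox :: "(real^'n \<Rightarrow> real) \<Rightarrow> real^'n \<Rightarrow> real^'n" where
  "prox p u = arg_min (\<lambda>x. p x + 1/2 * (norm (u - x))\<^sup>2) (\<lambda>_. True)"

section \<open>The problem and its dual\<close>

record ('n::finite, 'm::finite) qp =
  cost :: "real^'n"
  Qmat :: "real^'n^'n"
  Amat :: "real^'n^'m"
  rhs :: "real^'m"
  Dmat :: "real^'n^'n"
  lower :: "ereal^'n"
  upper :: "ereal^'n"

definition qp_data :: "('n::finite, 'm::finite) qp \<Rightarrow> bool" where
  "qp_data P \<longleftrightarrow> CARD('m) \<le> CARD('n) \<and>
     transpose (Qmat P) = Qmat P \<and> psd (Qmat P) \<and>
     is_diagonal (Dmat P) \<and> psd (Dmat P) \<and>
     (\<forall>i. lower P $ i \<le> upper P $ i)"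

definition gfun :: "('n::finite, 'm::finite) qp \<Rightarrow> real^'n \<Rightarrow> real" where
  "gfun P x = (\<Sum>i\<in>UNIV. \<bar>(Dmat P *v x) $ i\<bar>)"

definition Kset :: "('n::finite, 'm::finite) qp \<Rightarrow> (real^'n) set" where
  "Kset P = {x. \<forall>i. lower P $ i \<le> ereal (x $ i) \<and> ereal (x $ i) \<le> upper P $ i}"

definition primal_obj :: "('n::finite, 'm::finite) qp \<Rightarrow> real^'n \<Rightarrow> ereal" where
  "primal_obj P x =
     ereal (cost P \<bullet> x + 1/2 * (x \<bullet> (Qmat P *v x)) + gfun P x) + indicator_fun (Kset P) x"

definition dual_obj ::
  "('n::finite, 'm::finite) qp \<Rightarrow> real^'n \<Rightarrow> real^'m \<Rightarrow> real^'n \<Rightarrow> ereal" where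
  "dual_obj P x y z =
     ereal (rhs P \<bullet> y - 1/2 * (x \<bullet> (Qmat P *v x)))
     - fenchel_conj (indicator_fun (Kset P)) z
     - fenchel_conj (\<lambda>v. ereal (gfun P v)) (transpose (Amat P) *v y - cost P - Qmat P *v x - z)"

definition primal_feasible :: "('n::finite, 'm::finite) qp \<Rightarrow> bool" where
  "primal_feasible P \<longleftrightarrow> (\<exists>x. Amat P *v x = rhs P \<and> primal_obj P x < \<infinity>)"

definition dual_feasible :: "('n::finite, 'm::finite) qp \<Rightarrow> bool" where
  "dual_feasible P \<longleftrightarrow> (\<exists>x y z. dual_obj P x y z > -\<infinity>)"

section \<open>Algorithm PD-PMM\<close>

text \<open>The input sequences of the method, the SSN parameters \<open>\<zeta>\<^sub>k\<close>, and the outer iterates.\<close>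

record ('n::finite, 'm::finite) pdpmm =
  tau :: "nat \<Rightarrow> real"
  beta :: "nat \<Rightarrow> real"
  eps :: "nat \<Rightarrow> real"
  zeta :: "nat \<Rightarrow> real"
  xit :: "nat \<Rightarrow> real^'n"
  yit :: "nat \<Rightarrow> real^'m"
  zit :: "nat \<Rightarrow> real^'n"

definition rho :: "('n::finite, 'm::finite) pdpmm \<Rightarrow> nat \<Rightarrow> real" where
  "rho R k = beta R k / tau R k"

definition pdpmm_params ::
  "('n::finite, 'm::finite) pdpmm \<Rightarrow> real \<Rightarrow> ereal \<Rightarrow> bool" where
  "pdpmm_params R tau_inf beta_inf \<longleftrightarrow>
     (\<forall>k. tau R k > 0) \<and> decseq (tau R) \<and> tau R \<longlonglongrightarrow> tau_inf \<and> tau_inf > 0 \<and>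
     beta R 0 > 0 \<and> incseq (beta R) \<and> (\<lambda>k. ereal (beta R k)) \<longlonglongrightarrow> beta_inf \<and>
     (\<forall>k. eps R k > 0) \<and> eps R \<longlonglongrightarrow> 0"

text \<open>\<open>z\<^sub>k + \<beta>\<^sub>k x - \<beta>\<^sub>k \<Pi>\<^sub>K(\<beta>\<^sub>k\<^sup>-\<^sup>1 z\<^sub>k + x)\<close>, which occurs in both \<open>r\<close> and the update of \<open>z\<close>.\<close>

definition zupdate ::
  "('n::finite, 'm::finite) qp \<Rightarrow> ('n, 'm) pdpmm \<Rightarrow> nat \<Rightarrow> real^'n \<Rightarrow> real^'n" where
  "zupdate P R k x = (zit R k + beta R k *\<^sub>R x)
     - beta R k *\<^sub>R closest_point (Kset P) (inverse (beta R k) *\<^sub>R zit R k + x)"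

definition resid ::
  "('n::finite, 'm::finite) qp \<Rightarrow> ('n, 'm) pdpmm \<Rightarrow> nat \<Rightarrow> (real^'n) \<times> (real^'m) \<Rightarrow> real^'n" where
  "resid P R k = (\<lambda>(x, y). cost P + Qmat P *v x - transpose (Amat P) *v y
     + zupdate P R k x + inverse (rho R k) *\<^sub>R (x - xit R k))"

definition Fset ::
  "('n::finite, 'm::finite) qp \<Rightarrow> ('n, 'm) pdpmm \<Rightarrow> nat \<Rightarrow> (real^'n) \<times> (real^'m)
     \<Rightarrow> ((real^'n) \<times> (real^'m)) set" where
  "Fset P R k = (\<lambda>(x, y). {(u', v').
     (\<exists>s \<in> subdiff (gfun P) x. u' = resid P R k (x, y) + s) \<and>
     v' = Amat P *v x + inverse (beta R k) *\<^sub>R (y - yit R k) - rhs P})"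

text \<open>\<open>Fset\<close> is never empty since \<open>gfun\<close> is a finite convex function, so the convention
  \<open>infdist p {} = 0\<close> plays no role.\<close>

definition accepted ::
  "('n::finite, 'm::finite) qp \<Rightarrow> ('n, 'm) pdpmm \<Rightarrow> nat \<Rightarrow> (real^'n) \<times> (real^'m) \<Rightarrow> bool" where
  "accepted P R k p \<longleftrightarrow> infdist 0 (Fset P R k p) \<le> eps R k"

text \<open>The iterates up to index \<open>K\<close> are generated by the method, from an arbitrary initial point.\<close>

definition pdpmm_iterates ::
  "('n::finite, 'm::finite) qp \<Rightarrow> ('n, 'm) pdpmm \<Rightarrow> nat \<Rightarrow> bool" where
  "pdpmm_iterates P R K \<longleftrightarrow> (\<forall>k<K.
     accepted P R k (xit R (Suc k), yit R (Suc k)) \<and>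
     zit R (Suc k) = zupdate P R k (xit R (Suc k)))"

section \<open>Algorithm SSN\<close>

definition uhat ::
  "('n::finite, 'm::finite) qp \<Rightarrow> ('n, 'm) pdpmm \<Rightarrow> nat \<Rightarrow> (real^'n) \<times> (real^'m) \<Rightarrow> real^'n" where
  "uhat P R k p = fst p - zeta R k *\<^sub>R resid P R k p"

definition Fhat ::
  "('n::finite, 'm::finite) qp \<Rightarrow> ('n, 'm) pdpmm \<Rightarrow> nat \<Rightarrow> (real^'n) \<times> (real^'m)
     \<Rightarrow> (real^'n) \<times> (real^'m)" where
  "Fhat P R k p =
     (fst p - prox (\<lambda>v. zeta R k * gfun P v) (uhat P R k p),
      zeta R k *\<^sub>R (Amat P *v fst p + inverse (beta R k) *\<^sub>R (snd p - yit R k) - rhs P))"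

definition Theta ::
  "('n::finite, 'm::finite) qp \<Rightarrow> ('n, 'm) pdpmm \<Rightarrow> nat \<Rightarrow> (real^'n) \<times> (real^'m) \<Rightarrow> real" where
  "Theta P R k p = (norm (Fhat P R k p))\<^sup>2"

definition interior_idx ::
  "('n::finite, 'm::finite) qp \<Rightarrow> ('n, 'm) pdpmm \<Rightarrow> nat \<Rightarrow> (real^'n) \<times> (real^'m) \<Rightarrow> 'n set" where
  "interior_idx P R k p = {i.
     lower P $ i < ereal (inverse (beta R k) * zit R k $ i + fst p $ i) \<and>
     ereal (inverse (beta R k) * zit R k $ i + fst p $ i) < upper P $ i}"

definition Bmat ::
  "('n::finite, 'm::finite) qp \<Rightarrow> ('n, 'm) pdpmm \<Rightarrow> nat \<Rightarrow> (real^'n) \<times> (real^'m) \<Rightarrow> real^'n^'n" where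
  "Bmat P R k p = diag_mat (\<lambda>i. if i \<in> interior_idx P R k p then 1 else 0)"

definition Bhat ::
  "('n::finite, 'm::finite) qp \<Rightarrow> ('n, 'm) pdpmm \<Rightarrow> nat \<Rightarrow> (real^'n) \<times> (real^'m) \<Rightarrow> real^'n^'n" where
  "Bhat P R k p = diag_mat (\<lambda>i.
     if \<bar>uhat P R k p $ i\<bar> > zeta R k * Dmat P $ i $ i \<or> Dmat P $ i $ i = 0 then 1 else 0)"

definition Bhat_idx ::
  "('n::finite, 'm::finite) qp \<Rightarrow> ('n, 'm) pdpmm \<Rightarrow> nat \<Rightarrow> (real^'n) \<times> (real^'m) \<Rightarrow> 'n set" where
  "Bhat_idx P R k p = {i. Bhat P R k p $ i $ i = 1}"

definition Hmat ::
  "('n::finite, 'm::finite) qp \<Rightarrow> ('n, 'm) pdpmm \<Rightarrow> nat \<Rightarrow> (real^'n) \<times> (real^'m) \<Rightarrow> real^'n^'n" where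
  "Hmat P R k p = Qmat P + (beta R k + inverse (rho R k)) *\<^sub>R mat 1 - beta R k *\<^sub>R Bmat P R k p"

text \<open>The action of the block matrix \<open>M\<close> at the point \<open>p\<close> on a direction.\<close>

definition Mact ::
  "('n::finite, 'm::finite) qp \<Rightarrow> ('n, 'm) pdpmm \<Rightarrow> nat \<Rightarrow> (real^'n) \<times> (real^'m)
     \<Rightarrow> (real^'n) \<times> (real^'m) \<Rightarrow> (real^'n) \<times> (real^'m)" where
  "Mact P R k p = (\<lambda>(dx, dy).
     (((mat 1 - Bhat P R k p) + zeta R k *\<^sub>R (Bhat P R k p ** Hmat P R k p)) *v dx
        - (zeta R k *\<^sub>R (Bhat P R k p ** transpose (Amat P))) *v dy,
      (zeta R k *\<^sub>R Amat P) *v dx + (zeta R k * inverse (beta R k)) *\<^sub>R dy))"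

definition ssn_params ::
  "('n::finite, 'm::finite) pdpmm \<Rightarrow> nat \<Rightarrow> real \<Rightarrow> real \<Rightarrow> (nat \<Rightarrow> real) \<Rightarrow> bool" where
  "ssn_params R k \<mu> \<delta> \<eta> \<longleftrightarrow> zeta R k > 0 \<and> 0 < \<mu> \<and> \<mu> < 1/2 \<and> 0 < \<delta> \<and> \<delta> < 1 \<and>
     (\<forall>j. 0 < \<eta> j \<and> \<eta> j < 1)"

definition armijo ::
  "('n::finite, 'm::finite) qp \<Rightarrow> ('n, 'm) pdpmm \<Rightarrow> nat \<Rightarrow> real \<Rightarrow> real
     \<Rightarrow> (real^'n) \<times> (real^'m) \<Rightarrow> (real^'n) \<times> (real^'m) \<Rightarrow> nat \<Rightarrow> bool" where
  "armijo P R k \<mu> \<delta> p d l \<longleftrightarrow>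
     Theta P R k (p + \<delta> ^ l *\<^sub>R d) \<le> (1 - 2 * \<mu> * \<delta> ^ l) * Theta P R k p"

definition ssn_step ::
  "('n::finite, 'm::finite) qp \<Rightarrow> ('n, 'm) pdpmm \<Rightarrow> nat \<Rightarrow> real \<Rightarrow> real \<Rightarrow> real
     \<Rightarrow> (real^'n) \<times> (real^'m) \<Rightarrow> (real^'n) \<times> (real^'m) \<Rightarrow> bool" where
  "ssn_step P R k \<mu> \<delta> e p p' \<longleftrightarrow> (\<exists>d l.
     norm (Mact P R k p d + Fhat P R k p) \<le> e * norm (Fhat P R k p) \<and>
     armijo P R k \<mu> \<delta> p d l \<and> (\<forall>l'<l. \<not> armijo P R k \<mu> \<delta> p d l') \<and>
     p' = p + \<delta> ^ l *\<^sub>R d)"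

text \<open>The inner iterates \<open>w 0, \<dots>, w J\<close> for the \<open>k\<close>-th sub-problem; only the last one may already
  satisfy the stopping criterion.\<close>

definition ssn_iterates ::
  "('n::finite, 'm::finite) qp \<Rightarrow> ('n, 'm) pdpmm \<Rightarrow> nat \<Rightarrow> real \<Rightarrow> real \<Rightarrow> (nat \<Rightarrow> real)
     \<Rightarrow> (nat \<Rightarrow> (real^'n) \<times> (real^'m)) \<Rightarrow> nat \<Rightarrow> bool" where
  "ssn_iterates P R k \<mu> \<delta> \<eta> w J \<longleftrightarrow> w 0 = (xit R k, yit R k) \<and>
     (\<forall>j<J. \<not> accepted P R k (w j) \<and> ssn_step P R k \<mu> \<delta> (\<eta> j) (w j) (w (Suc j)))"

section \<open>The Schur complements\<close>

definition A_B ::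
  "('n::finite, 'm::finite) qp \<Rightarrow> ('n, 'm) pdpmm \<Rightarrow> nat \<Rightarrow> (real^'n) \<times> (real^'m) \<Rightarrow> real^'n^'m" where
  "A_B P R k p = submat UNIV (Bhat_idx P R k p) (Amat P)"

definition H_BB ::
  "('n::finite, 'm::finite) qp \<Rightarrow> ('n, 'm) pdpmm \<Rightarrow> nat \<Rightarrow> (real^'n) \<times> (real^'m) \<Rightarrow> real^'n^'n" where
  "H_BB P R k p = submat (Bhat_idx P R k p) (Bhat_idx P R k p) (Hmat P R k p)"

definition Htilde_BB ::
  "('n::finite, 'm::finite) qp \<Rightarrow> ('n, 'm) pdpmm \<Rightarrow> nat \<Rightarrow> (real^'n) \<times> (real^'m) \<Rightarrow> real^'n^'n" where
  "Htilde_BB P R k p = diag_mat (\<lambda>i. H_BB P R k p $ i $ i)"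

definition Emat ::
  "('n::finite, 'm::finite) qp \<Rightarrow> ('n, 'm) pdpmm \<Rightarrow> nat \<Rightarrow> (real^'n) \<times> (real^'m) \<Rightarrow> real^'n^'n" where
  "Emat P R k p = submat (Bhat_idx P R k p) (Bhat_idx P R k p) (diag_mat (\<lambda>i.
     if i \<in> interior_idx P R k p then inverse (Htilde_BB P R k p $ i $ i) else 0))"

definition S_hat ::
  "('n::finite, 'm::finite) qp \<Rightarrow> ('n, 'm) pdpmm \<Rightarrow> nat \<Rightarrow> (real^'n) \<times> (real^'m) \<Rightarrow> real^'m^'m" where
  "S_hat P R k p =
     A_B P R k p ** submat_inv (Bhat_idx P R k p) (Htilde_BB P R k p) ** transpose (A_B P R k p)
     + inverse (beta R k) *\<^sub>R mat 1"

definition S_tilde ::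
  "('n::finite, 'm::finite) qp \<Rightarrow> ('n, 'm) pdpmm \<Rightarrow> nat \<Rightarrow> (real^'n) \<times> (real^'m) \<Rightarrow> real^'m^'m" where
  "S_tilde P R k p =
     A_B P R k p ** Emat P R k p ** transpose (A_B P R k p) + inverse (beta R k) *\<^sub>R mat 1"

definition inverse_square :: "ereal \<Rightarrow> real" where
  "inverse_square b = (if b = \<infinity> then 0 else inverse ((real_of_ereal b)\<^sup>2))"

end

theory Submission
  imports Defs
begin

text \<open>
  Both matrices are symmetric positive definite, so an eigenvalue \<open>\<lambda>\<close> of \<open>S\<^sub>t\<inverse> S\<^sub>h\<close> is a real
  generalized eigenvalue \<open>S\<^sub>h u = \<lambda> S\<^sub>t u\<close> and a Rayleigh quotient. The quadratic form of
  \<open>S\<^sub>h - S\<^sub>t\<close> at \<open>u\<close> is the sum of \<open>(A\<^sup>T u)\<^sub>i\<^sup>2 / h\<^sub>i\<close> over those columns for which \<open>B\<close> vanishes. There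
  \<open>h\<^sub>i \<ge> \<beta>\<^sub>k + \<tau>\<^sub>k / \<beta>\<^sub>k\<close>, so this sum is at most \<open>\<sigma>\<^sup>2 \<parallel>u\<parallel>\<^sup>2 / (\<beta>\<^sub>k + \<tau>\<^sub>k / \<beta>\<^sub>k)\<close>, whereas the quadratic form
  of \<open>S\<^sub>t\<close> is at least \<open>\<parallel>u\<parallel>\<^sup>2 / \<beta>\<^sub>k\<close>. Finally \<open>\<tau>\<^sub>k / \<beta>\<^sub>k\<^sup>2 \<ge> \<tau>\<^sub>\<infinity> / \<beta>\<^sub>\<infinity>\<^sup>2\<close>.
\<close>

section \<open>Symmetric matrices and the largest singular value\<close>

lemma inner_symmetric_matrix:
  fixes M :: "real^'n^'n"
  assumes "transpose M = M"
  shows "x \<bullet> (M *v y) = y \<bullet> (M *v x)"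
  by (metis assms dot_lmul_matrix inner_commute transpose_matrix_vector)

text \<open>If \<open>N *v x\<close> were nonzero, a small step from \<open>x\<close> against it
  would make the quadratic form negative.\<close>

lemma psd_kernel:
  fixes N :: "real^'n^'n"
  assumes sym: "transpose N = N" and psd: "psd N" and 0: "x \<bullet> (N *v x) = 0"
  shows "N *v x = 0"
proof (rule ccontr)
  define y where "y = N *v x"
  define q where "q = y \<bullet> (N *v y)"
  assume "N *v x \<noteq> 0"
  then have pos: "y \<bullet> y > 0" by (simp add: y_def)
  have q: "q \<ge> 0" using psd by (simp add: psd_def q_def)
  \<comment> \<open>Small enough that the linear term dominates \<open>t\<^sup>2 * q\<close>; the
    \<open>+ 1\<close> covers \<open>q = 0\<close>.\<close>
  define t where "t = (y \<bullet> y) / (q + 1)"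
  have t: "t > 0" using pos q by (simp add: t_def)
  have "0 \<le> (x - t *\<^sub>R y) \<bullet> (N *v (x - t *\<^sub>R y))"
    using psd by (simp add: psd_def)
  also have "\<dots> = t\<^sup>2 * q - 2 * t * (y \<bullet> y)"
    using 0 inner_symmetric_matrix[OF sym, of x y]
    by (simp add: matrix_vector_mult_diff_distrib matrix_vector_mult_scaleR
        inner_diff_left inner_diff_right power2_eq_square algebra_simps q_def flip: y_def)
  finally have "2 * (y \<bullet> y) \<le> t * q"
    using t by (simp add: power2_eq_square field_simps)
  moreover have "t * q \<le> t * (q + 1)" using t by simp
  moreover have "t * (q + 1) = y \<bullet> y" using q by (simp add: t_def)
  ultimately show False using pos by linarith
qed

text \<open>The form attains its maximum \<open>l\<close> on the compact unit sphere. Then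
  \<open>l I - M\<close> is positive semidefinite and its form vanishes at the maximizer, which
  \<open>psd_kernel\<close> turns into an eigenvector.\<close>

lemma symmetric_matrix_max_eigenvalue:
  fixes M :: "real^'n^'n"
  assumes sym: "transpose M = M"
  obtains l where "eigenvalue M l" "\<And>x. x \<bullet> (M *v x) \<le> l * (x \<bullet> x)"
proof -
  have "continuous_on (sphere 0 1) (\<lambda>x. x \<bullet> (M *v x))"
    by (intro continuous_intros)
  moreover have "sphere (0::real^'n) 1 \<noteq> {}" by (simp add: sphere_eq_empty)
  ultimately obtain x0 where x0: "x0 \<in> sphere 0 1"
    and max: "\<And>x. x \<in> sphere 0 1 \<Longrightarrow> x \<bullet> (M *v x) \<le> x0 \<bullet> (M *v x0)"
    using continuous_attains_sup[OF compact_sphere, of 0 1 "\<lambda>x. x \<bullet> (M *v x)"] by blast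
  define l where "l = x0 \<bullet> (M *v x0)"
  have bound: "x \<bullet> (M *v x) \<le> l * (x \<bullet> x)" for x
  proof (cases "x = 0")
    case False
    define y where "y = inverse (norm x) *\<^sub>R x"
    have "y \<in> sphere 0 1" using False by (simp add: y_def)
    from max[OF this] have "inverse (norm x) * (inverse (norm x) * (x \<bullet> (M *v x))) \<le> l"
      by (simp add: y_def l_def matrix_vector_mult_scaleR)
    then show ?thesis
      using False by (simp add: field_simps dot_square_norm power2_eq_square)
  qed simp
  define N where "N = l *\<^sub>R mat 1 - M"
  have N: "N *v x = l *\<^sub>R x - M *v x" for x
    by (simp add: N_def matrix_vector_mult_diff_rdistrib flip: scaleR_matrix_vector_assoc)
  have "transpose N = N"
    using sym by (simp add: N_def vec_eq_iff transpose_def mat_def)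
  moreover have "psd N"
    using bound by (simp add: psd_def N inner_diff_right)
  moreover have "x0 \<bullet> (N *v x0) = 0"
    using x0 by (simp add: N inner_diff_right dot_square_norm flip: l_def)
  ultimately have "N *v x0 = 0" by (rule psd_kernel)
  then have "M *v x0 = l *s x0" by (simp add: N scalar_mult_eq_scaleR)
  moreover have "x0 \<noteq> 0" using x0 by auto
  ultimately show thesis using that bound by (auto simp: eigenvalue_def)
qed

text \<open>Eigenvectors of distinct eigenvalues are orthogonal, hence independent. Finiteness is
  what gives the \<open>Max\<close> in \<open>sigma_max\<close> its meaning.\<close>

lemma finite_eigenvalues_symmetric:
  fixes M :: "real^'n^'n"
  assumes sym: "transpose M = M"
  shows "finite {l. eigenvalue M l}"
proof -
  define E where "E = {l. eigenvalue M l}"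
  have "\<forall>l\<in>E. \<exists>v. v \<noteq> 0 \<and> M *v v = l *s v"
    by (simp add: E_def eigenvalue_def)
  then obtain v where v: "\<And>l. l \<in> E \<Longrightarrow> v l \<noteq> 0 \<and> M *v v l = l *s v l"
    by metis
  have orth: "v l \<bullet> v m = 0" if "l \<in> E" "m \<in> E" "l \<noteq> m" for l m
    using inner_symmetric_matrix[OF sym, of "v l" "v m"] v that
    by (simp add: scalar_mult_eq_scaleR inner_commute)
  have inj: "inj_on v E"
    using orth v by (metis inj_onI inner_eq_zero_iff)
  have "pairwise orthogonal (v ` E)"
    using orth by (auto simp: pairwise_def orthogonal_def)
  moreover have "0 \<notin> v ` E" using v by auto
  ultimately have "finite (v ` E)"
    using pairwise_orthogonal_independent independent_imp_finite by blast
  then show ?thesis using inj finite_imageD unfolding E_def by blast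
qed

text \<open>The form of \<open>transpose A ** A\<close> at \<open>x\<close> is the square of
  \<open>norm (A *v x)\<close>, so its top eigenvalue \<open>l\<close> bounds the norm, and
  \<open>sqrt l\<close> is one of the singular values.\<close>

lemma norm_mult_le_sigma_max:
  fixes A :: "real^'n^'m"
  shows "sigma_max A \<ge> 0" and "norm (A *v x) \<le> sigma_max A * norm x"
proof -
  define M where "M = transpose A ** A"
  have sym: "transpose M = M"
    by (simp add: M_def matrix_transpose_mul)
  have M: "y \<bullet> (M *v y) = (norm (A *v y))\<^sup>2" for y
    by (metis M_def dot_square_norm dot_lmul_matrix matrix_vector_mul_assoc inner_commute
        transpose_matrix_vector)
  obtain l where l: "eigenvalue M l" and le: "\<And>y. y \<bullet> (M *v y) \<le> l * (y \<bullet> y)"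
    using symmetric_matrix_max_eigenvalue[OF sym] by blast
  have l0: "l \<ge> 0"
    using le[of "axis undefined 1"] by (simp add: M inner_axis_axis) 
       (meson order_trans zero_le_power2)
  have "sqrt l \<le> sigma_max A"
    unfolding sigma_max_def singular_values_def
    using l finite_eigenvalues_symmetric[OF sym] by (auto simp: M_def intro!: Max_ge)
  moreover have "norm (A *v x) \<le> sqrt l * norm x"
  proof (rule power2_le_imp_le)
    show "(norm (A *v x))\<^sup>2 \<le> (sqrt l * norm x)\<^sup>2"
      using le[of x] l0 by (simp add: M power_mult_distrib dot_square_norm)
  qed (simp add: l0)
  ultimately show "sigma_max A \<ge> 0" "norm (A *v x) \<le> sigma_max A * norm x"
    using l0 real_sqrt_ge_zero order_trans mult_right_mono[of "sqrt l" "sigma_max A" "norm x"]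
    by (blast, force)
qed

text \<open>With \<open>w = transpose A *v u\<close>, the square of \<open>norm w\<close> equals
  \<open>u \<bullet> (A *v w)\<close>; Cauchy-Schwarz and cancelling \<open>norm w\<close> give the
  bound without comparing the spectra of the two Gram matrices.\<close>

lemma norm_transpose_mult_le_sigma_max:
  fixes A :: "real^'n^'m"
  shows "norm (transpose A *v u) \<le> sigma_max A * norm u"
proof (cases "transpose A *v u = 0")
  case True
  then show ?thesis by (simp add: norm_mult_le_sigma_max(1))
next
  case False
  define w where "w = transpose A *v u"
  have "norm w * norm w = u \<bullet> (A *v w)"
    by (metis w_def dot_lmul_matrix dot_square_norm power2_eq_square transpose_matrix_vector
        inner_commute)
  also have "\<dots> \<le> norm u * norm (A *v w)" by (rule norm_cauchy_schwarz)
  also have "\<dots> \<le> norm u * (sigma_max A * norm w)"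
    by (intro mult_left_mono norm_mult_le_sigma_max) simp
  finally show ?thesis
    using False by (simp add: mult.left_commute[of "norm u"] mult.commute[of "norm u"]
        mult.assoc[symmetric] mult_right_le_imp_le flip: w_def del: transpose_matrix_vector)
qed

text \<open>A complex eigenvector \<open>a + i b\<close> satisfies \<open>S v = lam T v\<close>.
  Symmetry and definiteness force \<open>Im lam = 0\<close>, after which whichever of
  \<open>a\<close>, \<open>b\<close> is nonzero serves as \<open>u\<close>.\<close>

lemma complex_eigenvalue_inverse_product:
  fixes S T :: "real^'n^'n"
  assumes S: "transpose S = S" and T: "transpose T = T"
    and pos: "\<And>x. x \<noteq> 0 \<Longrightarrow> x \<bullet> (T *v x) > 0"
    and ev: "eigenvalue (map_matrix complex_of_real (matrix_inv T ** S)) lam"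
  obtains u where "lam \<in> \<real>" "u \<noteq> 0" "S *v u = Re lam *\<^sub>R (T *v u)"
proof -
  define K where "K = matrix_inv T ** S"
  have "invertible T"
    using pos by (metis invertible_left_inverse matrix_left_invertible_ker inner_zero_right
        less_irrefl)
  then have "T ** matrix_inv T = mat 1"
    unfolding invertible_def matrix_inv_def by (rule someI2_ex) blast
  then have TK: "T *v (K *v x) = S *v x" for x
    by (simp add: K_def matrix_vector_mul_assoc matrix_mul_assoc)
  obtain v where v0: "v \<noteq> 0" and v: "map_matrix complex_of_real K *v v = lam *s v"
    using ev by (auto simp: eigenvalue_def K_def)
  define a where "a = (\<chi> i. Re (v $ i))"
  define b where "b = (\<chi> i. Im (v $ i))"
  define s where "s = Re lam"
  define t where "t = Im lam"
  have comp: "(\<Sum>j\<in>UNIV. complex_of_real (K $ i $ j) * v $ j) = lam * v $ i" for i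
    using v by (simp add: vec_eq_iff matrix_vector_mult_def map_matrix_def)
  have "K *v a = s *\<^sub>R a - t *\<^sub>R b"
    using arg_cong[OF comp, of Re]
    by (simp add: vec_eq_iff matrix_vector_mult_def a_def b_def s_def t_def)
  then have Sa: "S *v a = s *\<^sub>R (T *v a) - t *\<^sub>R (T *v b)"
    using TK[of a] by (simp add: matrix_vector_mult_diff_distrib matrix_vector_mult_scaleR)
  have "K *v b = t *\<^sub>R a + s *\<^sub>R b"
    using arg_cong[OF comp, of Im]
    by (simp add: vec_eq_iff matrix_vector_mult_def a_def b_def s_def t_def algebra_simps)
  then have Sb: "S *v b = t *\<^sub>R (T *v a) + s *\<^sub>R (T *v b)"
    using TK[of b] by (simp add: matrix_vector_right_distrib matrix_vector_mult_scaleR)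
  have ab: "a \<noteq> 0 \<or> b \<noteq> 0"
    using v0 by (auto simp: a_def b_def vec_eq_iff complex_eq_iff)
  have nonneg: "x \<bullet> (T *v x) \<ge> 0" for x
    using pos[of x] by (cases "x = 0") auto
  \<comment> \<open>Pair \<open>Sb\<close> with \<open>a\<close> and \<open>Sa\<close> with
    \<open>b\<close>: the two values agree by symmetry of \<open>S\<close>, and the \<open>s\<close>
    terms cancel by symmetry of \<open>T\<close>.\<close>
  have "t * (a \<bullet> (T *v a) + b \<bullet> (T *v b)) = 0"
    using inner_symmetric_matrix[OF S, of a b] inner_symmetric_matrix[OF T, of a b]
    by (simp add: Sa Sb inner_diff_right inner_add_right algebra_simps)
  moreover have "a \<bullet> (T *v a) + b \<bullet> (T *v b) > 0"
    using ab pos nonneg by (meson add_nonneg_pos add_pos_nonneg)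
  ultimately have t: "t = 0" by simp
  have "S *v a = Re lam *\<^sub>R (T *v a)" "S *v b = Re lam *\<^sub>R (T *v b)"
    using Sa Sb t by (auto simp: s_def)
  moreover have "lam \<in> \<real>" using t by (simp add: t_def complex_is_Real_iff)
  ultimately show thesis using ab that by blast
qed

section \<open>Schur complements built from zero-padded blocks\<close>

text \<open>Since \<open>inverse 0 = 0\<close>, entrywise inversion preserves the padding. For
  uniqueness, the product with \<open>diag_mat d\<close> fixes the rows in \<open>J\<close>, and
  padding makes the other rows zero.\<close>

lemma submat_inv_diag_mat:
  fixes d :: "'n::finite \<Rightarrow> real"
  assumes nz: "\<And>i. i \<in> J \<Longrightarrow> d i \<noteq> 0" and z: "\<And>i. i \<notin> J \<Longrightarrow> d i = 0"
  shows "submat_inv J (diag_mat d) = diag_mat (\<lambda>i. inverse (d i))"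
  unfolding submat_inv_def
proof (rule the_equality)
  show "submat J J (diag_mat (\<lambda>i. inverse (d i))) = diag_mat (\<lambda>i. inverse (d i)) \<and>
    diag_mat d ** diag_mat (\<lambda>i. inverse (d i)) = submat J J (mat 1) \<and>
    diag_mat (\<lambda>i. inverse (d i)) ** diag_mat d = submat J J (mat 1)"
    using nz z by (auto simp: vec_eq_iff submat_def diag_mat_def mat_def matrix_matrix_mult_def
        if_distrib[of "\<lambda>x. x * _"] if_distrib[of "\<lambda>x. _ * x"] cong: if_cong)
next
  fix N assume N: "submat J J N = N \<and> diag_mat d ** N = submat J J (mat 1) \<and>
    N ** diag_mat d = submat J J (mat 1)"
  have mult: "(diag_mat d ** N) $ i $ j = d i * N $ i $ j" for i j
    by (simp add: diag_mat_def matrix_matrix_mult_def if_distrib[of "\<lambda>x. x * _"] cong: if_cong)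
  have "N $ i $ j = diag_mat (\<lambda>i. inverse (d i)) $ i $ j" for i j
  proof (cases "i \<in> J")
    case True
    have "d i * N $ i $ j = submat J J (mat 1) $ i $ j"
      using N mult by metis
    then show ?thesis
      using True nz[OF True] by (cases "i = j") (auto simp: submat_def mat_def diag_mat_def field_simps split: if_splits)
  next
    case False
    then have "submat J J N $ i $ j = 0" by (simp add: submat_def)
    then show ?thesis using N z[OF False] by (auto simp: diag_mat_def)
  qed
  then show "N = diag_mat (\<lambda>i. inverse (d i))" by (simp add: vec_eq_iff)
qed

text \<open>Both Schur complements have this shape and differ only in the weights \<open>d\<close>,
  so comparing them reduces to comparing weights. The bilinear form also yields their
  symmetry.\<close>

lemma inner_column_weighted_gram:
  fixes A :: "real^'n^'m"
  shows "x \<bullet> ((submat UNIV J A ** diag_mat d ** transpose (submat UNIV J A) + c *\<^sub>R mat 1) *v y)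
    = (\<Sum>i\<in>J. d i * (transpose A *v x) $ i * (transpose A *v y) $ i) + c * (x \<bullet> y)"
proof -
  let ?C = "submat UNIV J A"
  have C: "(transpose ?C *v z) $ i = (if i \<in> J then (transpose A *v z) $ i else 0)" for z i
    by (simp add: submat_def transpose_def matrix_vector_mult_def)
  have D: "(diag_mat d *v z) $ i = d i * z $ i" for z i
    by (simp add: diag_mat_def matrix_vector_mult_def if_distrib[of "\<lambda>x. x * _"] cong: if_cong)
  have "x \<bullet> (?C *v z) = (transpose ?C *v x) \<bullet> z" for z
    by (metis dot_lmul_matrix transpose_matrix_vector)
  then have "x \<bullet> ((?C ** diag_mat d ** transpose ?C) *v y)
      = (transpose ?C *v x) \<bullet> (diag_mat d *v (transpose ?C *v y))"
    by (simp flip: matrix_vector_mul_assoc)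
  also have "\<dots> = (\<Sum>i\<in>UNIV. if i \<in> J
      then d i * (transpose A *v x) $ i * (transpose A *v y) $ i else 0)"
    by (auto simp: inner_vec_def C D simp del: transpose_matrix_vector intro!: sum.cong)
  also have "\<dots> = (\<Sum>i\<in>J. d i * (transpose A *v x) $ i * (transpose A *v y) $ i)"
    by (simp add: sum.If_cases)
  finally show ?thesis
    by (simp add: matrix_vector_mult_add_rdistrib inner_add_right flip: scaleR_matrix_vector_assoc)
qed

lemma transpose_column_weighted_gram:
  fixes A :: "real^'n^'m"
  shows "transpose (submat UNIV J A ** diag_mat d ** transpose (submat UNIV J A) + c *\<^sub>R mat 1)
    = submat UNIV J A ** diag_mat d ** transpose (submat UNIV J A) + c *\<^sub>R mat 1"
    (is "transpose ?S = ?S")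
proof -
  have "x \<bullet> (transpose ?S *v y) = x \<bullet> (?S *v y)" for x y
  proof -
    have "x \<bullet> (transpose ?S *v y) = y \<bullet> (?S *v x)"
      by (metis dot_lmul_matrix inner_commute transpose_matrix_vector)
    also have "\<dots> = x \<bullet> (?S *v y)"
      unfolding inner_column_weighted_gram by (simp add: inner_commute mult.commute mult.left_commute)
    finally show ?thesis .
  qed
  then show ?thesis
    by (metis matrix_eq vector_eq_rdot inner_commute)
qed

section \<open>Bounds on the data and the eigenvalue estimate\<close>

lemma psd_diag_nonneg:
  assumes "psd M"
  shows "M $ i $ i \<ge> 0"
  using assms[unfolded psd_def, rule_format, of "axis i 1"]
  by (simp add: inner_axis' matrix_vector_mult_basis column_def)

text \<open>Monotone sequences lie on one side of their limits: \<open>tau_inf\<close> is below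
  every \<open>tau R k\<close> and \<open>beta_inf\<close> above every
  \<open>beta R k\<close>.\<close>

lemma inverse_square_beta_tau_le:
  assumes "pdpmm_params R tau_inf beta_inf"
  shows "beta R k > 0" and "tau R k > 0"
    and "inverse_square beta_inf * tau_inf \<le> tau R k / (beta R k)\<^sup>2"
proof -
  have inc: "incseq (beta R)" and "beta R 0 > 0" and lim: "(\<lambda>k. ereal (beta R k)) \<longlonglongrightarrow> beta_inf"
    and dec: "decseq (tau R)" and "tau R \<longlonglongrightarrow> tau_inf" and "tau_inf > 0"
    using assms by (auto simp: pdpmm_params_def)
  then have tau: "tau_inf \<le> tau R k" by (simp add: decseq_ge)
  show tau0: "tau R k > 0" using tau \<open>tau_inf > 0\<close> by simp
  have "beta R 0 \<le> beta R k" using inc by (simp add: incseq_def)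
  with \<open>beta R 0 > 0\<close> show beta: "beta R k > 0" by simp
  have "incseq (\<lambda>k. ereal (beta R k))" using inc by (simp add: incseq_def)
  then have le: "ereal (beta R k) \<le> beta_inf" using lim by (rule incseq_le)
  show "inverse_square beta_inf * tau_inf \<le> tau R k / (beta R k)\<^sup>2"
  proof (cases beta_inf)
    case (real r)
    then have "beta R k \<le> r" using le by simp
    then have "inverse (r\<^sup>2) \<le> inverse ((beta R k)\<^sup>2)"
      using beta by (intro le_imp_inverse_le power_mono) auto
    then have "inverse (r\<^sup>2) * tau_inf \<le> inverse ((beta R k)\<^sup>2) * tau R k"
      using tau \<open>tau_inf > 0\<close> by (intro mult_mono) auto
    then show ?thesis using real by (simp add: inverse_square_def field_simps)
  \<comment> \<open>For an infinite limit the left side is 0; the value minus infinity contradicts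
    \<open>le\<close>.\<close>
  qed (use le tau0 in \<open>auto simp: inverse_square_def\<close>)
qed

theorem lemma3p1:
  fixes P :: "('n::finite, 'm::finite) qp"
    and R :: "('n, 'm) pdpmm"
    and tau_inf :: real and beta_inf :: ereal
    and \<mu> \<delta> :: real and \<eta> :: "nat \<Rightarrow> real"
    and w :: "nat \<Rightarrow> (real^'n) \<times> (real^'m)"
    and k j :: nat
    and lam :: complex
  assumes "qp_data P"
    and "primal_feasible P" and "dual_feasible P"
    and "pdpmm_params R tau_inf beta_inf"
    and "pdpmm_iterates P R k"
    and "ssn_params R k \<mu> \<delta> \<eta>"
    and "ssn_iterates P R k \<mu> \<delta> \<eta> w j"
    and "eigenvalue
           (map_matrix complex_of_real (matrix_inv (S_tilde P R k (w j)) ** S_hat P R k (w j))) lam"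
  shows "lam \<in> \<real> \<and> 1 \<le> Re lam \<and>
    Re lam \<le> 1 + (sigma_max (Amat P))\<^sup>2 * (1 / (1 + inverse_square beta_inf * tau_inf))"
proof -
  define p where "p = w j"
  define A where "A = Amat P"
  define J where "J = Bhat_idx P R k p"
  define I where "I = interior_idx P R k p"
  define \<beta> where "\<beta> = beta R k"
  define \<tau> where "\<tau> = tau R k"
  \<comment> \<open>The diagonal of \<open>Hmat\<close>, with \<open>inverse (rho R k)\<close>
    written as \<tau> / \<beta>.\<close>
  define h where "h i = Qmat P $ i $ i + \<beta> + \<tau> / \<beta> - (if i \<in> I then \<beta> else 0)" for i
  define dS where "dS i = inverse (if i \<in> J then h i else 0)" for i
  define dT where "dT i = (if i \<in> J \<inter> I then inverse (h i) else 0)" for i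
  define S where "S = S_hat P R k p"
  define T where "T = S_tilde P R k p"
  note params = inverse_square_beta_tau_le[OF assms(4), of k, folded \<beta>_def \<tau>_def]
  have iq: "0 \<le> inverse_square beta_inf * tau_inf"
    using assms(4) by (simp add: pdpmm_params_def inverse_square_def)
  have Q: "Qmat P $ i $ i \<ge> 0" for i
    using assms(1) by (auto simp: qp_data_def intro: psd_diag_nonneg)
  have h: "h i > 0" for i
    using Q[of i] params(1,2) by (auto simp: h_def intro: add_nonneg_pos add_pos_pos)
  have Hd: "Hmat P R k p $ i $ i = h i" for i
    by (simp add: Hmat_def h_def mat_def Bmat_def diag_mat_def rho_def I_def \<beta>_def \<tau>_def)
  have Ht: "Htilde_BB P R k p = diag_mat (\<lambda>i. if i \<in> J then h i else 0)"
    unfolding Htilde_BB_def H_BB_def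
    by (intro arg_cong[of _ _ diag_mat] ext) (simp add: submat_def Hd J_def)
  have "submat_inv J (Htilde_BB P R k p) = diag_mat dS"
    unfolding Ht dS_def using h by (intro submat_inv_diag_mat) (auto simp: less_le)
  then have S: "S = submat UNIV J A ** diag_mat dS ** transpose (submat UNIV J A)
      + inverse \<beta> *\<^sub>R mat 1"
    by (simp add: S_def S_hat_def A_B_def J_def A_def \<beta>_def)
  have "Emat P R k p = diag_mat dT"
    unfolding Emat_def Ht
    by (auto simp: vec_eq_iff submat_def diag_mat_def dT_def J_def I_def)
  then have T: "T = submat UNIV J A ** diag_mat dT ** transpose (submat UNIV J A)
      + inverse \<beta> *\<^sub>R mat 1"
    by (simp add: T_def S_tilde_def A_B_def J_def A_def \<beta>_def)
  \<comment> \<open>The weights \<open>dT\<close> are nonnegative, so only the regularization term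
    is kept.\<close>
  have qT: "u \<bullet> (T *v u) \<ge> inverse \<beta> * (u \<bullet> u)" for u
    unfolding T inner_column_weighted_gram using h
    by (auto simp: dT_def mult.assoc less_imp_le intro!: sum_nonneg mult_nonneg_nonneg[OF _ zero_le_square])
  have posT: "u \<bullet> (T *v u) > 0" if "u \<noteq> 0" for u
    using qT[of u] that params(1) by (smt (verit) inner_gt_zero_iff mult_pos_pos
        positive_imp_inverse_positive)
  obtain u where real: "lam \<in> \<real>" and u: "u \<noteq> 0" and ev: "S *v u = Re lam *\<^sub>R (T *v u)"
    using assms(8) posT unfolding p_def[symmetric] S_def[symmetric] T_def[symmetric]
    by (elim complex_eigenvalue_inverse_product[rotated 3])
       (auto simp: S T transpose_column_weighted_gram)
  define \<sigma> where "\<sigma> = sigma_max A"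
  define f where "f i = (transpose A *v u) $ i" for i
  define g where "g = (\<Sum>i\<in>J. (dS i - dT i) * (f i)\<^sup>2)"
  \<comment> \<open>A lower bound for \<open>h\<close> off \<open>I\<close>, where \<beta> is not
    subtracted and the diagonal of \<open>Qmat\<close> is nonnegative.\<close>
  define L where "L = \<beta> + \<tau> / \<beta>"
  have L: "L > 0" using params(1,2) by (simp add: L_def add_pos_pos)
  have gT: "(Re lam - 1) * (u \<bullet> (T *v u)) = g"
  proof -
    have "u \<bullet> (S *v u) - u \<bullet> (T *v u) = g"
      unfolding S T inner_column_weighted_gram
      by (simp add: g_def f_def power2_eq_square algebra_simps flip: sum_subtractf)
    then show ?thesis by (simp add: ev algebra_simps)
  qed
  \<comment> \<open>The weights differ only on \<open>J - I\<close>, where the difference is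
    \<open>inverse (h i)\<close>.\<close>
  have d: "0 \<le> dS i - dT i" "dS i - dT i \<le> inverse L" for i
    using h[of i] Q[of i] L
    by (auto simp: dS_def dT_def less_imp_le) (auto simp: h_def L_def intro!: le_imp_inverse_le)
  have g0: "g \<ge> 0" unfolding g_def using d by (intro sum_nonneg) simp
  have "g \<le> (\<Sum>i\<in>J. inverse L * (f i)\<^sup>2)"
    unfolding g_def using d by (intro sum_mono mult_right_mono) auto
  also have "\<dots> \<le> (\<Sum>i\<in>UNIV. inverse L * (f i)\<^sup>2)"
    using L by (intro sum_mono2) auto
  also have "\<dots> = inverse L * (norm (transpose A *v u))\<^sup>2"
    unfolding f_def dot_square_norm[symmetric] inner_vec_def
    by (simp add: sum_distrib_left power2_eq_square)
  also have "\<dots> \<le> inverse L * (\<sigma> * norm u)\<^sup>2"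
    using L unfolding \<sigma>_def
    by (intro mult_left_mono power_mono norm_transpose_mult_le_sigma_max) auto
  finally have gle: "g \<le> inverse L * \<sigma>\<^sup>2 * (u \<bullet> u)"
    by (simp add: power_mult_distrib dot_square_norm)
  have lower: "Re lam - 1 \<ge> 0"
    using gT g0 posT[OF u] by (metis zero_le_mult_iff linorder_not_le)
  \<comment> \<open>Multiplying \<open>qT\<close> by \<open>Re lam - 1\<close> needs its sign, so
    the lower bound on the eigenvalue comes first.\<close>
  have "(Re lam - 1) * (inverse \<beta> * (u \<bullet> u)) \<le> inverse L * \<sigma>\<^sup>2 * (u \<bullet> u)"
    using mult_left_mono[OF qT[of u] lower] gT gle by linarith
  then have "(Re lam - 1) * inverse \<beta> \<le> inverse L * \<sigma>\<^sup>2"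
    using u by (simp flip: mult.assoc)
  then have "Re lam - 1 \<le> \<sigma>\<^sup>2 * (\<beta> / L)"
    using params(1) L by (simp add: field_simps)
  also have "\<beta> / L = 1 / (1 + \<tau> / \<beta>\<^sup>2)"
    using params(1) L by (simp add: L_def field_simps power2_eq_square)
  \<comment> \<open>Passing to the limits can only shrink the denominator, and \<open>iq\<close>
    keeps it positive.\<close>
  also have "\<sigma>\<^sup>2 * \<dots> \<le> \<sigma>\<^sup>2 * (1 / (1 + inverse_square beta_inf * tau_inf))"
    using params iq by (intro mult_left_mono divide_left_mono mult_pos_pos) auto
  finally show ?thesis
    using real lower by (simp add: \<sigma>_def A_def)
qed

end
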